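(* For every integer $t\ge 1$, the domination number of the undirected zero divisor graph $\overline{\Gamma}(\mathbb{Z}_{2^t}[i,j,k])$ is $1$.
   Context: $\mathbb{Z}_n[i,j,k]=\{a+bi+cj+dk: a,b,c,d\in\mathbb{Z}_n\}$ is the ring of Lipschitz quaternions modulo $n$, with $i^2=j^2=k^2=ijk=-1$ and coefficients in $\mathbb{Z}_n$ (integers modulo $n$) central. For a ring $R$, an element $x$ is a zero divisor if there is a nonzero $y\in R$ with $xy=0$ or $yx=0$. The undirected zero divisor graph $\overline{\Gamma}(R)$ is the simple graph whose vertices are the nonzero zero divisors of $R$, with distinct $x,y$ adjacent iff $xy=0$ or $yx=0$. A dominating set of a graph $G$ is a set $D$ of vertices such that every vertex not in $D$ is adjacent to at least one member of $D$; the domination number is the minimum cardinality of a dominating set. *)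

theory Defs
  imports
    "HOL-Number_Theory.Residues"
    "Graph_Theory.Pair_Digraph"
begin

section \<open>Lipschitz quaternions over a coefficient ring\<close>

text \<open>The value \<open>Quat a b c d\<close> stands for \<open>a + b i + c j + d k\<close>.\<close>

datatype 'a quat = Quat (q_re: 'a) (q_i: 'a) (q_j: 'a) (q_k: 'a)

definition quat_ring :: "('a, 'b) ring_scheme \<Rightarrow> 'a quat ring"
  where "quat_ring R =
    \<lparr>carrier = {Quat a b c d | a b c d.
        a \<in> carrier R \<and> b \<in> carrier R \<and> c \<in> carrier R \<and> d \<in> carrier R},
     monoid.mult = \<lambda>x y. Quat
       (q_re x \<otimes>\<^bsub>R\<^esub> q_re y \<ominus>\<^bsub>R\<^esub> q_i x \<otimes>\<^bsub>R\<^esub> q_i y \<ominus>\<^bsub>R\<^esub> q_j x \<otimes>\<^bsub>R\<^esub> q_j y \<ominus>\<^bsub>R\<^esub> q_k x \<otimes>\<^bsub>R\<^esub> q_k y)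
       (q_re x \<otimes>\<^bsub>R\<^esub> q_i y \<oplus>\<^bsub>R\<^esub> q_i x \<otimes>\<^bsub>R\<^esub> q_re y \<oplus>\<^bsub>R\<^esub> q_j x \<otimes>\<^bsub>R\<^esub> q_k y \<ominus>\<^bsub>R\<^esub> q_k x \<otimes>\<^bsub>R\<^esub> q_j y)
       (q_re x \<otimes>\<^bsub>R\<^esub> q_j y \<ominus>\<^bsub>R\<^esub> q_i x \<otimes>\<^bsub>R\<^esub> q_k y \<oplus>\<^bsub>R\<^esub> q_j x \<otimes>\<^bsub>R\<^esub> q_re y \<oplus>\<^bsub>R\<^esub> q_k x \<otimes>\<^bsub>R\<^esub> q_i y)
       (q_re x \<otimes>\<^bsub>R\<^esub> q_k y \<oplus>\<^bsub>R\<^esub> q_i x \<otimes>\<^bsub>R\<^esub> q_j y \<ominus>\<^bsub>R\<^esub> q_j x \<otimes>\<^bsub>R\<^esub> q_i y \<oplus>\<^bsub>R\<^esub> q_k x \<otimes>\<^bsub>R\<^esub> q_re y),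
     one = Quat \<one>\<^bsub>R\<^esub> \<zero>\<^bsub>R\<^esub> \<zero>\<^bsub>R\<^esub> \<zero>\<^bsub>R\<^esub>,
     zero = Quat \<zero>\<^bsub>R\<^esub> \<zero>\<^bsub>R\<^esub> \<zero>\<^bsub>R\<^esub> \<zero>\<^bsub>R\<^esub>,
     add = \<lambda>x y. Quat (q_re x \<oplus>\<^bsub>R\<^esub> q_re y) (q_i x \<oplus>\<^bsub>R\<^esub> q_i y)
                      (q_j x \<oplus>\<^bsub>R\<^esub> q_j y) (q_k x \<oplus>\<^bsub>R\<^esub> q_k y)\<rparr>"

definition lipschitz_mod :: "nat \<Rightarrow> int quat ring"
  where "lipschitz_mod n = quat_ring (residue_ring (int n))"

context residues
begin

lemma quat_ring_mod_simps:
  shows "carrier (quat_ring R) = {Quat a b c d | a b c d.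
      {a, b, c, d} \<subseteq> {0..<m}}"
    and "Quat a b c d \<oplus>\<^bsub>quat_ring R\<^esub> Quat e f g h =
      Quat ((a + e) mod m) ((b + f) mod m) ((c + g) mod m) ((d + h) mod m)"
    and "Quat a b c d \<otimes>\<^bsub>quat_ring R\<^esub> Quat e f g h = Quat
      ((a * e - b * f - c * g - d * h) mod m)
      ((a * f + b * e + c * h - d * g) mod m)
      ((a * g - b * h + c * e + d * f) mod m)
      ((a * h + b * g - c * f + d * e) mod m)"
    and "\<zero>\<^bsub>quat_ring R\<^esub> = Quat 0 0 0 0"
    and "\<one>\<^bsub>quat_ring R\<^esub> = Quat 1 0 0 0"
  by (auto simp: quat_ring_def res_carrier_eq res_add_eq res_mult_eq res_neg_eq res_zero_eq
      res_one_eq a_minus_def mod_simps)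

lemma ring_quat_ring: "ring (quat_ring R)"
proof -
  have mod_cong: "[u mod m = u] (mod m)" for u
    by simp
  \<comment> \<open>strips every inner \<open>mod m\<close> from both sides of an equation\<close>
  have mod_eq: "u mod m = v mod m" if "[u = u'] (mod m)" "[v = v'] (mod m)" "u' = v'" for u u' v v'
    using that by (simp add: cong_def)
  show ?thesis
  proof (rule ringI)
    show "abelian_group (quat_ring R)"
    proof (rule abelian_groupI)
      fix x y z :: "int quat"
      show "x \<oplus>\<^bsub>quat_ring R\<^esub> y \<oplus>\<^bsub>quat_ring R\<^esub> z = x \<oplus>\<^bsub>quat_ring R\<^esub> (y \<oplus>\<^bsub>quat_ring R\<^esub> z)"
        by (cases x; cases y; cases z)
           (simp only: quat_ring_mod_simps mod_simps, simp add: add.assoc)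
      show "x \<oplus>\<^bsub>quat_ring R\<^esub> y = y \<oplus>\<^bsub>quat_ring R\<^esub> x"
        by (cases x; cases y) (simp add: quat_ring_mod_simps add.commute)
    next
      fix x assume "x \<in> carrier (quat_ring R)"
      then obtain a b c d where "x = Quat a b c d"
        by (auto simp: quat_ring_mod_simps)
      then show "\<exists>y\<in>carrier (quat_ring R). y \<oplus>\<^bsub>quat_ring R\<^esub> x = \<zero>\<^bsub>quat_ring R\<^esub>"
        using m_gt_one
        by (intro bexI[of _ "Quat (- a mod m) (- b mod m) (- c mod m) (- d mod m)"])
           (simp_all add: quat_ring_mod_simps mod_simps)
    qed (use m_gt_one in \<open>auto simp: quat_ring_mod_simps\<close>)
    show "monoid (quat_ring R)"
    proof (rule monoidI)
      fix x y z :: "int quat"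
      show "x \<otimes>\<^bsub>quat_ring R\<^esub> y \<otimes>\<^bsub>quat_ring R\<^esub> z = x \<otimes>\<^bsub>quat_ring R\<^esub> (y \<otimes>\<^bsub>quat_ring R\<^esub> z)"
        by (cases x; cases y; cases z; simp only: quat_ring_mod_simps quat.inject; intro conjI;
            rule mod_eq, (rule mod_cong cong_diff cong_add cong_mult cong_refl)+,
            simp add: algebra_simps)
    qed (use m_gt_one in \<open>auto simp: quat_ring_mod_simps\<close>)
  next
    fix x y z :: "int quat"
    show "(x \<oplus>\<^bsub>quat_ring R\<^esub> y) \<otimes>\<^bsub>quat_ring R\<^esub> z =
        x \<otimes>\<^bsub>quat_ring R\<^esub> z \<oplus>\<^bsub>quat_ring R\<^esub> y \<otimes>\<^bsub>quat_ring R\<^esub> z"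
      by (cases x; cases y; cases z; simp only: quat_ring_mod_simps quat.inject; intro conjI;
            rule mod_eq, (rule mod_cong cong_diff cong_add cong_mult cong_refl)+,
            simp add: algebra_simps)
    show "z \<otimes>\<^bsub>quat_ring R\<^esub> (x \<oplus>\<^bsub>quat_ring R\<^esub> y) =
        z \<otimes>\<^bsub>quat_ring R\<^esub> x \<oplus>\<^bsub>quat_ring R\<^esub> z \<otimes>\<^bsub>quat_ring R\<^esub> y"
      by (cases x; cases y; cases z; simp only: quat_ring_mod_simps quat.inject; intro conjI;
            rule mod_eq, (rule mod_cong cong_diff cong_add cong_mult cong_refl)+,
            simp add: algebra_simps)
  qed
qed

lemma quat_ring_relations:
  defines "Q \<equiv> quat_ring R"
    and "I \<equiv> Quat 0 1 0 0" and "J \<equiv> Quat 0 0 1 0" and "K \<equiv> Quat 0 0 0 1"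
  shows "I \<otimes>\<^bsub>Q\<^esub> I = \<ominus>\<^bsub>Q\<^esub> \<one>\<^bsub>Q\<^esub>" "J \<otimes>\<^bsub>Q\<^esub> J = \<ominus>\<^bsub>Q\<^esub> \<one>\<^bsub>Q\<^esub>" "K \<otimes>\<^bsub>Q\<^esub> K = \<ominus>\<^bsub>Q\<^esub> \<one>\<^bsub>Q\<^esub>"
    "I \<otimes>\<^bsub>Q\<^esub> J \<otimes>\<^bsub>Q\<^esub> K = \<ominus>\<^bsub>Q\<^esub> \<one>\<^bsub>Q\<^esub>"
proof -
  interpret Q: ring Q
    unfolding Q_def by (rule ring_quat_ring)
  have "\<ominus>\<^bsub>Q\<^esub> \<one>\<^bsub>Q\<^esub> = Quat (- 1 mod m) 0 0 0"
    by (rule Q.minus_equality)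
       (use m_gt_one in \<open>auto simp: Q_def quat_ring_mod_simps mod_simps\<close>)
  then show "I \<otimes>\<^bsub>Q\<^esub> I = \<ominus>\<^bsub>Q\<^esub> \<one>\<^bsub>Q\<^esub>" "J \<otimes>\<^bsub>Q\<^esub> J = \<ominus>\<^bsub>Q\<^esub> \<one>\<^bsub>Q\<^esub>" "K \<otimes>\<^bsub>Q\<^esub> K = \<ominus>\<^bsub>Q\<^esub> \<one>\<^bsub>Q\<^esub>"
    "I \<otimes>\<^bsub>Q\<^esub> J \<otimes>\<^bsub>Q\<^esub> K = \<ominus>\<^bsub>Q\<^esub> \<one>\<^bsub>Q\<^esub>"
    using m_gt_one by (simp_all add: Q_def I_def J_def K_def quat_ring_mod_simps mod_simps)
qed

end

lemma ring_lipschitz_mod: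
  assumes "n > 1"
  shows "ring (lipschitz_mod n)"
proof -
  interpret residues "int n" "residue_ring (int n)"
    using assms by unfold_locales auto
  show ?thesis
    unfolding lipschitz_mod_def by (rule ring_quat_ring)
qed


section \<open>The undirected zero divisor graph\<close>

text \<open>By this definition zero is a zero divisor of every nontrivial ring.\<close>

definition zero_divisor :: "('a, 'b) ring_scheme \<Rightarrow> 'a \<Rightarrow> bool"
  where "zero_divisor R x \<longleftrightarrow> x \<in> carrier R \<and>
    (\<exists>y\<in>carrier R. y \<noteq> \<zero>\<^bsub>R\<^esub> \<and> (x \<otimes>\<^bsub>R\<^esub> y = \<zero>\<^bsub>R\<^esub> \<or> y \<otimes>\<^bsub>R\<^esub> x = \<zero>\<^bsub>R\<^esub>))"

text \<open>An undirected simple graph is a symmetric irreflexive digraph without parallel arcs;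
  if it is finite, this is the locale \<^locale>\<open>pair_graph\<close>.\<close>

definition zero_divisor_graph :: "('a, 'b) ring_scheme \<Rightarrow> 'a pair_pre_digraph"
  where "zero_divisor_graph R =
    (let V = {x. zero_divisor R x \<and> x \<noteq> \<zero>\<^bsub>R\<^esub>} in
     \<lparr>pverts = V,
      parcs = {(x, y). x \<in> V \<and> y \<in> V \<and> x \<noteq> y \<and>
                (x \<otimes>\<^bsub>R\<^esub> y = \<zero>\<^bsub>R\<^esub> \<or> y \<otimes>\<^bsub>R\<^esub> x = \<zero>\<^bsub>R\<^esub>)}\<rparr>)"

lemma pair_graph_zero_divisor_graph:
  assumes "finite (carrier R)"
  shows "pair_graph (zero_divisor_graph R)"
proof -
  let ?G = "zero_divisor_graph R"
  have V: "finite (pverts ?G)"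
    by (rule finite_subset[OF _ assms]) (auto simp: zero_divisor_graph_def zero_divisor_def)
  moreover have "finite (parcs ?G)"
    by (rule finite_subset[of _ "pverts ?G \<times> pverts ?G"])
       (use V in \<open>auto simp: zero_divisor_graph_def\<close>)
  ultimately show ?thesis
    by unfold_locales
       (auto simp: zero_divisor_graph_def symmetric_def sym_def)
qed

lemma finite_carrier_lipschitz_mod: "finite (carrier (lipschitz_mod n))"
proof (rule finite_subset)
  let ?C = "{0..int n - 1}"
  show "carrier (lipschitz_mod n) \<subseteq> (\<lambda>(a, b, c, d). Quat a b c d) ` (?C \<times> ?C \<times> ?C \<times> ?C)"
    by (force simp: lipschitz_mod_def quat_ring_def residue_ring_def)
qed simp


section \<open>Domination\<close>

definition dominating_set :: "'a pair_pre_digraph \<Rightarrow> 'a set \<Rightarrow> bool"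
  where "dominating_set G D \<longleftrightarrow>
    D \<subseteq> pverts G \<and> (\<forall>v \<in> pverts G - D. \<exists>u \<in> D. (u, v) \<in> parcs G)"

text \<open>The minimum exists whenever \<open>G\<close> is finite, since \<open>pverts G\<close> is a dominating set; on
  graphs without a finite dominating set the value is unspecified.\<close>

definition domination_number :: "'a pair_pre_digraph \<Rightarrow> nat"
  where "domination_number G = (LEAST k. \<exists>D. dominating_set G D \<and> finite D \<and> card D = k)"

end

theory Submission
  imports Defs
begin

text \<open>
  A quaternion \<open>x = a + b i + c j + d k\<close> satisfies \<open>x\<^sup>* x = x x\<^sup>* = N\<close>, where
  \<open>N = a\<^sup>2 + b\<^sup>2 + c\<^sup>2 + d\<^sup>2\<close>. So if \<open>N\<close> is odd, \<open>x\<close> is a unit modulo \<open>2\<^sup>t\<close>, and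
  every zero divisor must have even \<open>N\<close>
  (\<open>zero_divisor_imp_not_coprime_norm\<close>). Since squaring preserves parity, this
  means that \<open>a + b + c + d\<close> is even.

  The single vertex that dominates the graph is \<open>w = 2\<^sup>t\<^sup>-\<^sup>1 (1 + i + j + k)\<close>. Every
  coefficient of \<open>(1 + i + j + k) x\<close> has the form \<open>\<plusminus>a \<plusminus> b \<plusminus> c \<plusminus> d\<close>, which has the same
  parity as \<open>a + b + c + d\<close>; hence \<open>w x = 0\<close> as soon as that sum is even
  (\<open>half_modulus_mult_eq_zero\<close>). The same fact with \<open>x = w\<close> gives \<open>w\<^sup>2 = 0\<close>, so
  \<open>w\<close> is itself a vertex; in particular the graph is nonempty and the empty set
  does not dominate it.
\<close>

text \<open>With \<open>x = a + b i + c j + d k\<close> and \<open>y = e + f i + g j + h k\<close>, multiplying the congruence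
  \<open>x y = 0\<close> modulo \<open>m\<close> on the left by the conjugate of \<open>x\<close> turns it into \<open>N y = 0\<close>, where \<open>N\<close>
  can be cancelled. Over the integers this is the list of four identities in the proof.\<close>

lemma quat_mult_cancel_norm:
  fixes a b c d e f g h m :: int
  assumes norm: "coprime m (a\<^sup>2 + b\<^sup>2 + c\<^sup>2 + d\<^sup>2)"
    and prod: "m dvd a * e - b * f - c * g - d * h" "m dvd a * f + b * e + c * h - d * g"
      "m dvd a * g - b * h + c * e + d * f" "m dvd a * h + b * g - c * f + d * e"
  shows "m dvd e \<and> m dvd f \<and> m dvd g \<and> m dvd h"
proof -
  let ?N = "a\<^sup>2 + b\<^sup>2 + c\<^sup>2 + d\<^sup>2"
  let ?p = "a * e - b * f - c * g - d * h" and ?q = "a * f + b * e + c * h - d * g"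
    and ?r = "a * g - b * h + c * e + d * f" and ?s = "a * h + b * g - c * f + d * e"
  have "?N * e = a * ?p + b * ?q + c * ?r + d * ?s"
    "?N * f = a * ?q - b * ?p - c * ?s + d * ?r"
    "?N * g = a * ?r + b * ?s - c * ?p - d * ?q"
    "?N * h = a * ?s - b * ?r + c * ?q - d * ?p"
    by (simp_all add: algebra_simps power2_eq_square)
  then have "m dvd ?N * e" "m dvd ?N * f" "m dvd ?N * g" "m dvd ?N * h"
    using prod by (simp_all only: dvd_add dvd_diff dvd_mult)
  then show ?thesis
    using norm by (simp add: coprime_dvd_mult_right_iff)
qed

context residues
begin

text \<open>A coprime norm would make the element cancellable on either side.\<close>

lemma zero_divisor_imp_not_coprime_norm:
  assumes "zero_divisor (quat_ring R) (Quat a b c d)"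
  shows "\<not> coprime m (a\<^sup>2 + b\<^sup>2 + c\<^sup>2 + d\<^sup>2)"
proof
  assume norm: "coprime m (a\<^sup>2 + b\<^sup>2 + c\<^sup>2 + d\<^sup>2)"
  obtain y where y: "y \<in> carrier (quat_ring R)" "y \<noteq> \<zero>\<^bsub>quat_ring R\<^esub>"
    and y_prod: "Quat a b c d \<otimes>\<^bsub>quat_ring R\<^esub> y = \<zero>\<^bsub>quat_ring R\<^esub>
      \<or> y \<otimes>\<^bsub>quat_ring R\<^esub> Quat a b c d = \<zero>\<^bsub>quat_ring R\<^esub>"
    using assms unfolding zero_divisor_def by blast
  obtain e f g h where y_eq: "y = Quat e f g h"
    by (cases y)
  have range: "e \<in> {0..<m}" "f \<in> {0..<m}" "g \<in> {0..<m}" "h \<in> {0..<m}"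
    and nonzero: "\<not> (e = 0 \<and> f = 0 \<and> g = 0 \<and> h = 0)"
    using y by (simp_all add: y_eq quat_ring_mod_simps(1,4))
  have prod: "Quat a b c d \<otimes>\<^bsub>quat_ring R\<^esub> Quat e f g h = Quat 0 0 0 0
      \<or> Quat e f g h \<otimes>\<^bsub>quat_ring R\<^esub> Quat a b c d = Quat 0 0 0 0"
    using y_prod by (simp only: y_eq quat_ring_mod_simps(4))
  from prod have "m dvd e \<and> m dvd f \<and> m dvd g \<and> m dvd h"
  proof
    assume "Quat a b c d \<otimes>\<^bsub>quat_ring R\<^esub> Quat e f g h = Quat 0 0 0 0"
    then show ?thesis
      by (intro quat_mult_cancel_norm[OF norm])
        (simp_all add: quat_ring_mod_simps(3) mod_eq_0_iff_dvd)
  next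
    assume yx: "Quat e f g h \<otimes>\<^bsub>quat_ring R\<^esub> Quat a b c d = Quat 0 0 0 0"
    \<comment> \<open>Conjugation reverses products and preserves the norm, so the cancellation applies to
        the conjugates of both factors.\<close>
    have "m dvd e \<and> m dvd - f \<and> m dvd - g \<and> m dvd - h"
    proof (rule quat_mult_cancel_norm)
      show "coprime m (a\<^sup>2 + (- b)\<^sup>2 + (- c)\<^sup>2 + (- d)\<^sup>2)"
        using norm by simp
      have dvds: "m dvd e * a - f * b - g * c - h * d" "m dvd e * b + f * a + g * d - h * c"
        "m dvd e * c - f * d + g * a + h * b" "m dvd e * d + f * c - g * b + h * a"
        using yx unfolding quat_ring_mod_simps(3) quat.inject mod_eq_0_iff_dvd by blast+
      have conj: "a * e - (- b) * (- f) - (- c) * (- g) - (- d) * (- h)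
          = e * a - f * b - g * c - h * d"
        "a * (- f) + (- b) * e + (- c) * (- h) - (- d) * (- g)
          = - (e * b + f * a + g * d - h * c)"
        "a * (- g) - (- b) * (- h) + (- c) * e + (- d) * (- f)
          = - (e * c - f * d + g * a + h * b)"
        "a * (- h) + (- b) * (- g) - (- c) * (- f) + (- d) * e
          = - (e * d + f * c - g * b + h * a)"
        by (simp_all add: algebra_simps)
      show "m dvd a * e - (- b) * (- f) - (- c) * (- g) - (- d) * (- h)"
        "m dvd a * (- f) + (- b) * e + (- c) * (- h) - (- d) * (- g)"
        "m dvd a * (- g) - (- b) * (- h) + (- c) * e + (- d) * (- f)"
        "m dvd a * (- h) + (- b) * (- g) - (- c) * (- f) + (- d) * e"
        unfolding conj dvd_minus_iff by (fact dvds)+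
    qed
    then show ?thesis
      by simp
  qed
  then have "e = 0 \<and> f = 0 \<and> g = 0 \<and> h = 0"
    using range by (simp add: dvd_eq_mod_eq_0)
  with nonzero show False
    by contradiction
qed

text \<open>The factor \<open>s\<close> contributes half of the modulus, and the missing 2 is a parity statement,
  which is insensitive to the signs in the quaternion product.\<close>

lemma half_modulus_mult_eq_zero:
  assumes "m = 2 * s" and "even (a + b + c + d)"
  shows "Quat s s s s \<otimes>\<^bsub>quat_ring R\<^esub> Quat a b c d = \<zero>\<^bsub>quat_ring R\<^esub>"
proof -
  have "even (a - b - c - d)" "even (b + a + d - c)" "even (c - d + a + b)" "even (d + c - b + a)"
    using assms(2) by auto
  then have "m dvd s * (a - b - c - d)" "m dvd s * (b + a + d - c)"
    "m dvd s * (c - d + a + b)" "m dvd s * (d + c - b + a)"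
    unfolding assms(1) by (metis mult.commute mult_dvd_mono dvd_refl)+
  then show ?thesis
    by (simp add: quat_ring_mod_simps(3,4) mod_eq_0_iff_dvd distrib_left right_diff_distrib)
qed

end

lemma domination_number_eq_1I:
  assumes "w \<in> pverts G" and "\<And>v. v \<in> pverts G \<Longrightarrow> v \<noteq> w \<Longrightarrow> (w, v) \<in> parcs G"
  shows "domination_number G = 1"
  unfolding domination_number_def
proof (rule Least_equality)
  show "\<exists>D. dominating_set G D \<and> finite D \<and> card D = 1"
    using assms by (intro exI[of _ "{w}"]) (auto simp: dominating_set_def)
  fix k assume "\<exists>D. dominating_set G D \<and> finite D \<and> card D = k"
  then obtain D where D: "dominating_set G D" "finite D" "card D = k"
    by blast
  have "D \<noteq> {}"
    using D(1) assms(1) by (auto simp: dominating_set_def)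
  with D(2,3) show "1 \<le> k"
    by (auto simp: Suc_le_eq card_gt_0_iff)
qed

theorem theorem9:
  fixes t :: nat
  assumes "t \<ge> 1"
  shows "domination_number (zero_divisor_graph (lipschitz_mod (2 ^ t))) = 1"
proof -
  define s :: int where "s = 2 ^ (t - 1)"
  define m where "m = int (2 ^ t)"
  have m_eq: "m = 2 * s"
    using assms by (simp add: m_def s_def flip: power_Suc)
  have s_pos: "s > 0"
    by (simp add: s_def)
  with m_eq have s_less: "s < m"
    by simp
  interpret residues m "residue_ring m"
    using m_eq s_pos by unfold_locales auto
  let ?Q = "quat_ring (residue_ring m)" and ?w = "Quat s s s s"
  have w_carrier: "?w \<in> carrier ?Q" and w_nonzero: "?w \<noteq> \<zero>\<^bsub>?Q\<^esub>"
    using s_less s_pos by (auto simp: quat_ring_mod_simps(1,4))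
  have kills: "?w \<otimes>\<^bsub>?Q\<^esub> x = \<zero>\<^bsub>?Q\<^esub>" if "zero_divisor ?Q x" for x
  proof (cases x)
    case (Quat a b c d)
    have "\<not> coprime m (a\<^sup>2 + b\<^sup>2 + c\<^sup>2 + d\<^sup>2)"
      using that zero_divisor_imp_not_coprime_norm by (simp add: Quat)
    then have "even (a\<^sup>2 + b\<^sup>2 + c\<^sup>2 + d\<^sup>2)"
      by (auto simp: m_def)
    then show ?thesis
      unfolding Quat by (intro half_modulus_mult_eq_zero[OF m_eq]) auto
  qed
  have "?w \<otimes>\<^bsub>?Q\<^esub> ?w = \<zero>\<^bsub>?Q\<^esub>"
    by (rule half_modulus_mult_eq_zero[OF m_eq]) simp
  then have w_zero_divisor: "zero_divisor ?Q ?w"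
    using w_carrier w_nonzero by (auto simp: zero_divisor_def)
  have "domination_number (zero_divisor_graph ?Q) = 1"
    by (rule domination_number_eq_1I[of ?w])
      (use w_zero_divisor w_nonzero kills in \<open>auto simp: zero_divisor_graph_def\<close>)
  then show ?thesis
    by (simp add: lipschitz_mod_def m_def)
qed

end
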